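(* Let $\Gamma$ be a finite simple graph. The monoid $\operatorname{MR}(\Gamma)$ is a regular monoid if and only if $\Gamma$ is an empty graph (a graph with no edges) or a complete graph $K_n$.
   Context: For a finite simple graph $\Gamma=(V,E)$, the simplices of $\Gamma$ are the singletons $\{v\}$, $v\in V$, and the edges $\{u,v\}\in E$. The Margolis-Rhodes monoid $\operatorname{MR}(\Gamma)$ is the monoid of all partial functions $f:V\to V$ (acting on the right, composed left to right) such that for every simplex $\sigma$ the full preimage $\sigma f^{-1}=\{v\in\operatorname{Dom}(f)\mid vf\in\sigma\}$ is a simplex or empty. A monoid $M$ is regular if for every $a\in M$ there is $b\in M$ with $aba=a$. *)

theory Defs
  imports "HOL-Algebra.Group"
begin

locale finite_simple_graph =
  fixes V :: "'a set" and E :: "'a set set"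
  assumes finite_V: "finite V"
    and edges: "\<And>e. e \<in> E \<Longrightarrow> e \<subseteq> V \<and> card e = 2"

definition simplices :: "'a set \<Rightarrow> 'a set set \<Rightarrow> 'a set set"
  where "simplices V E = {{v} | v. v \<in> V} \<union> E"

definition edgeless_graph :: "'a set \<Rightarrow> 'a set set \<Rightarrow> bool"
  where "edgeless_graph V E \<longleftrightarrow> E = {}"

definition complete_graph :: "'a set \<Rightarrow> 'a set set \<Rightarrow> bool"
  where "complete_graph V E \<longleftrightarrow> (\<forall>u\<in>V. \<forall>v\<in>V. u \<noteq> v \<longrightarrow> {u, v} \<in> E)"

definition preimage :: "('a \<rightharpoonup> 'b) \<Rightarrow> 'b set \<Rightarrow> 'a set"
  where "preimage f S = {v \<in> dom f. the (f v) \<in> S}"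

text \<open>
  Maps act on the right, so the product of f and g is "first f, then g", which is
  g \<open>\<circ>\<^sub>m\<close> f in the notation of the library.
\<close>
definition MR :: "'a set \<Rightarrow> 'a set set \<Rightarrow> ('a \<rightharpoonup> 'a) monoid"
  where "MR V E =
    \<lparr>carrier = {f. dom f \<subseteq> V \<and> ran f \<subseteq> V \<and>
        (\<forall>\<sigma>\<in>simplices V E. preimage f \<sigma> \<in> simplices V E \<union> {{}})},
     mult = (\<lambda>f g. g \<circ>\<^sub>m f),
     one = (\<lambda>v. if v \<in> V then Some v else None)\<rparr>"

locale regular_monoid = monoid +
  assumes regular: "a \<in> carrier G \<Longrightarrow> \<exists>b\<in>carrier G. a \<otimes> b \<otimes> a = a"

lemma preimage_comp: "preimage (g \<circ>\<^sub>m f) S = preimage f (preimage g S)"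
  by (auto simp: preimage_def map_comp_def dom_def split: option.splits)

lemma (in finite_simple_graph) monoid_MR: "monoid (MR V E)"
proof (rule monoidI)
  fix f g assume f: "f \<in> carrier (MR V E)" and g: "g \<in> carrier (MR V E)"
  have empty: "preimage h {} = {}" for h :: "'a \<rightharpoonup> 'a"
    by (simp add: preimage_def)
  have dom_f: "dom f \<subseteq> V" and ran_g: "ran g \<subseteq> V"
    using f g by (auto simp: MR_def)
  have pre: "preimage h \<sigma> \<in> simplices V E \<union> {{}}"
    if "h \<in> carrier (MR V E)" "\<sigma> \<in> simplices V E \<union> {{}}" for h \<sigma>
    using that empty[of h] by (auto simp: MR_def)
  have "dom (g \<circ>\<^sub>m f) \<subseteq> V" "ran (g \<circ>\<^sub>m f) \<subseteq> V"
    using dom_f ran_g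
    by (auto simp: map_comp_def dom_def ran_def split: option.splits)
  moreover have "preimage (g \<circ>\<^sub>m f) \<sigma> \<in> simplices V E \<union> {{}}" if "\<sigma> \<in> simplices V E" for \<sigma>
    unfolding preimage_comp using pre[OF f] pre[OF g] that by blast
  ultimately show "f \<otimes>\<^bsub>MR V E\<^esub> g \<in> carrier (MR V E)"
    by (simp add: MR_def)
next
  have "preimage (\<lambda>v. if v \<in> V then Some v else None) \<sigma> = \<sigma>" if "\<sigma> \<in> simplices V E" for \<sigma>
    using that edges by (fastforce simp: preimage_def simplices_def dom_def split: if_splits)
  then show "\<one>\<^bsub>MR V E\<^esub> \<in> carrier (MR V E)"
    by (auto simp: MR_def ran_def split: if_splits)
next
  fix f assume f: "f \<in> carrier (MR V E)"
  show "\<one>\<^bsub>MR V E\<^esub> \<otimes>\<^bsub>MR V E\<^esub> f = f"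
  proof
    fix v
    have "f v = None" if "v \<notin> V"
      using f that by (cases "f v") (auto simp: MR_def)
    then show "(\<one>\<^bsub>MR V E\<^esub> \<otimes>\<^bsub>MR V E\<^esub> f) v = f v"
      by (simp add: MR_def map_comp_def)
  qed
  show "f \<otimes>\<^bsub>MR V E\<^esub> \<one>\<^bsub>MR V E\<^esub> = f"
    using f by (auto simp: MR_def map_comp_def fun_eq_iff ran_def split: option.splits)
next
  fix f g h
  show "f \<otimes>\<^bsub>MR V E\<^esub> g \<otimes>\<^bsub>MR V E\<^esub> h = f \<otimes>\<^bsub>MR V E\<^esub> (g \<otimes>\<^bsub>MR V E\<^esub> h)"
    by (auto simp: MR_def map_comp_def fun_eq_iff split: option.splits)
qed

end

theory Submission
  imports Defs
begin

text \<open>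
  The monoid treats edges and non-edges asymmetrically. Its elements never send two distinct
  non-adjacent vertices onto the two ends of an edge, but they may send the ends of an edge
  to distinct non-adjacent vertices. If there are an edge \<open>{u, v}\<close> and distinct non-adjacent \<open>x\<close>, \<open>y\<close>,
  the map \<open>u \<mapsto> x\<close>, \<open>v \<mapsto> y\<close> lies in the monoid, and any \<open>b\<close> with \<open>a b a = a\<close> would have to
  send \<open>x\<close>, \<open>y\<close> back to \<open>u\<close>, \<open>v\<close>, which is forbidden.

  Conversely, every partial map \<open>a\<close> satisfies \<open>a b a = a\<close> for a partial injection \<open>b\<close>, which
  picks one preimage for each point in the range of \<open>a\<close>. The preimage of a set under \<open>b\<close> is no
  larger than the set. In an edgeless graph the simplices are the one-point sets, in a
  complete graph they are all sets of one or two vertices, so in both cases the size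
  bound alone puts \<open>b\<close> into the monoid.
\<close>

text \<open>
  The axiom of choice gives a quasi-inverse that is injective, even if \<open>a\<close> is not:
  points with different images under \<open>a\<close> are different.
\<close>
lemma ex_injective_quasi_inverse:
  fixes a :: "'a \<rightharpoonup> 'b"
  obtains b where "dom b = ran a" "ran b \<subseteq> dom a" "inj_on b (dom b)"
    "a \<circ>\<^sub>m (b \<circ>\<^sub>m a) = a"
proof -
  define c where "c w = (SOME v. a v = Some w)" for w
  define b where "b w = (if w \<in> ran a then Some (c w) else None)" for w
  have c: "a (c w) = Some w" if "w \<in> ran a" for w
    using that unfolding c_def ran_def by (auto intro: someI)
  have "dom b = ran a"
    by (auto simp: b_def dom_def)
  moreover have "ran b \<subseteq> dom a"
    using c by (auto simp: b_def ran_def[of b])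
  moreover have "inj_on b (dom b)"
  proof (rule inj_onI)
    fix w w' assume "w \<in> dom b" "w' \<in> dom b" and eq: "b w = b w'"
    then have ran: "w \<in> ran a" "w' \<in> ran a"
      by (auto simp: b_def split: if_splits)
    with eq have "c w = c w'"
      by (simp add: b_def)
    with c[OF ran(1)] c[OF ran(2)] show "w = w'"
      by (metis option.inject)
  qed
  moreover have "a \<circ>\<^sub>m (b \<circ>\<^sub>m a) = a"
    using c by (auto simp: fun_eq_iff map_comp_def b_def ranI split: option.splits)
  ultimately show ?thesis
    by (rule that)
qed

lemma card_preimage_le:
  assumes "inj_on b (dom b)" "finite S"
  shows "card (preimage b S) \<le> card S"
proof (rule card_inj_on_le[where f = "\<lambda>v. the (b v)"])
  show "inj_on (\<lambda>v. the (b v)) (preimage b S)"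
    using assms(1) by (auto simp: inj_on_def preimage_def dom_def)
  show "(\<lambda>v. the (b v)) ` preimage b S \<subseteq> S"
    by (auto simp: preimage_def)
qed (rule assms(2))

context finite_simple_graph
begin

lemma mem_simplicesD:
  assumes "\<sigma> \<in> simplices V E"
  shows "\<sigma> \<subseteq> V" "card \<sigma> = 1 \<or> \<sigma> \<in> E \<and> card \<sigma> = 2"
  using assms edges by (auto simp: simplices_def)

lemma simplex_containing_pair:
  assumes "\<sigma> \<in> simplices V E" "x \<in> \<sigma>" "y \<in> \<sigma>" "x \<noteq> y"
  shows "{x, y} \<in> E"
proof -
  have "card \<sigma> \<noteq> 1"
    using assms(2-4) by (metis card_1_singletonE singletonD)
  with mem_simplicesD(2)[OF assms(1)] have \<sigma>: "\<sigma> \<in> E" "card \<sigma> = 2"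
    by blast+
  then obtain p q where "\<sigma> = {p, q}"
    by (meson card_2_iff)
  with assms(2-4) have "\<sigma> = {x, y}"
    by blast
  with \<sigma>(1) show ?thesis
    by simp
qed

lemma card_le_1_simplex:
  assumes "S \<subseteq> V" "card S \<le> 1"
  shows "S \<in> simplices V E \<union> {{}}"
proof (cases "card S = 0")
  case True
  then show ?thesis
    using assms finite_V finite_subset by fastforce
next
  case False
  with assms(2) have "card S = 1" by simp
  then show ?thesis
    using assms(1) by (auto simp: card_1_singleton_iff simplices_def)
qed

text \<open>
  In these two families being a simplex is a matter of size alone: without edges only size 1
  occurs, and if an edge occurs, the graph is complete and every pair of vertices is an edge.
\<close>
lemma simplex_if_card_le:
  assumes graph: "edgeless_graph V E \<or> complete_graph V E"
    and \<sigma>: "\<sigma> \<in> simplices V E" and S: "S \<subseteq> V" "card S \<le> card \<sigma>"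
  shows "S \<in> simplices V E \<union> {{}}"
proof (cases "card S \<le> 1")
  case True
  with S(1) show ?thesis by (rule card_le_1_simplex)
next
  case False
  with mem_simplicesD(2)[OF \<sigma>] S(2) have "card S = 2" "E \<noteq> {}"
    by auto
  then obtain x y where "S = {x, y}" "x \<noteq> y" "complete_graph V E"
    using graph by (auto simp: card_2_iff edgeless_graph_def)
  then show ?thesis
    using S(1) by (auto simp: complete_graph_def simplices_def)
qed

lemma partial_injection_in_MR:
  assumes graph: "edgeless_graph V E \<or> complete_graph V E"
    and b: "dom b \<subseteq> V" "ran b \<subseteq> V" "inj_on b (dom b)"
  shows "b \<in> carrier (MR V E)"
proof -
  have "preimage b \<sigma> \<in> simplices V E \<union> {{}}" if \<sigma>: "\<sigma> \<in> simplices V E" for \<sigma>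
  proof (rule simplex_if_card_le[OF graph \<sigma>])
    show "preimage b \<sigma> \<subseteq> V"
      using b(1) by (auto simp: preimage_def)
    show "card (preimage b \<sigma>) \<le> card \<sigma>"
      using b(3) finite_subset[OF mem_simplicesD(1)[OF \<sigma>] finite_V] by (rule card_preimage_le)
  qed
  with b(1,2) show ?thesis
    by (simp add: MR_def)
qed

lemma regular_MR:
  assumes graph: "edgeless_graph V E \<or> complete_graph V E"
  shows "regular_monoid (MR V E)"
proof (intro regular_monoid.intro regular_monoid_axioms.intro monoid_MR)
  fix a assume "a \<in> carrier (MR V E)"
  then have a: "dom a \<subseteq> V" "ran a \<subseteq> V"
    by (simp_all add: MR_def)
  obtain b where b: "dom b = ran a" "ran b \<subseteq> dom a" "inj_on b (dom b)"
      "a \<circ>\<^sub>m (b \<circ>\<^sub>m a) = a"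
    by (rule ex_injective_quasi_inverse)
  have "b \<in> carrier (MR V E)"
    using b a by (intro partial_injection_in_MR[OF graph]) auto
  moreover have "a \<otimes>\<^bsub>MR V E\<^esub> b \<otimes>\<^bsub>MR V E\<^esub> a = a"
    using b(4) by (simp add: MR_def)
  ultimately show "\<exists>b\<in>carrier (MR V E). a \<otimes>\<^bsub>MR V E\<^esub> b \<otimes>\<^bsub>MR V E\<^esub> a = a"
    by blast
qed

text \<open>
  No edge contains both \<open>x\<close> and \<open>y\<close>, so no simplex has a preimage with more than one point.
\<close>
lemma edge_to_nonedge_in_MR:
  assumes uv: "u \<in> V" "v \<in> V" and xy: "x \<in> V" "y \<in> V" "x \<noteq> y" "{x, y} \<notin> E"
  shows "[u \<mapsto> x, v \<mapsto> y] \<in> carrier (MR V E)"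
proof -
  let ?f = "[u \<mapsto> x, v \<mapsto> y]"
  have "preimage ?f \<sigma> \<in> simplices V E \<union> {{}}" if \<sigma>: "\<sigma> \<in> simplices V E" for \<sigma>
  proof -
    have "x \<notin> \<sigma> \<or> y \<notin> \<sigma>"
      using simplex_containing_pair[OF \<sigma>] xy(3,4) by blast
    then have "preimage ?f \<sigma> \<subseteq> {u} \<or> preimage ?f \<sigma> \<subseteq> {v}"
      by (auto simp: preimage_def split: if_splits)
    then have "preimage ?f \<sigma> \<in> {{}, {u}, {v}}"
      by (auto dest: subset_singletonD)
    then show ?thesis
      using uv by (auto simp: simplices_def)
  qed
  moreover have "ran ?f \<subseteq> V"
    using xy(1,2) by (auto simp: ran_def split: if_splits)
  ultimately show ?thesis
    using uv by (simp add: MR_def)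
qed

text \<open>
  This is where non-adjacent vertices are kept from the ends of an edge: the preimage of the
  edge must be a simplex, and it contains two distinct points.
\<close>
lemma MR_edge_lift:
  assumes b: "b \<in> carrier (MR V E)" and uv: "{u, v} \<in> E"
    and bx: "b x = Some u" and by': "b y = Some v" and "x \<noteq> y"
  shows "{x, y} \<in> E"
proof -
  let ?S = "preimage b {u, v}"
  have sub: "{x, y} \<subseteq> ?S"
    using bx by' by (auto simp: preimage_def)
  have "{u, v} \<in> simplices V E"
    using uv by (simp add: simplices_def)
  with b sub have S: "?S \<in> simplices V E"
    by (auto simp: MR_def)
  then show ?thesis
    using sub \<open>x \<noteq> y\<close> by (intro simplex_containing_pair) auto
qed

lemma edgeless_or_complete_if_regular_MR:
  assumes "regular_monoid (MR V E)"
  shows "edgeless_graph V E \<or> complete_graph V E"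
proof (rule ccontr)
  assume not: "\<not> ?thesis"
  then obtain x y where xy: "x \<in> V" "y \<in> V" "x \<noteq> y" "{x, y} \<notin> E"
    by (auto simp: complete_graph_def)
  from not obtain e where "e \<in> E"
    by (auto simp: edgeless_graph_def)
  with edges[of e] obtain u v where uv: "{u, v} \<in> E" "u \<in> V" "v \<in> V" "u \<noteq> v"
    by (auto simp: card_2_iff)
  let ?a = "[u \<mapsto> x, v \<mapsto> y]"
  obtain b where b: "b \<in> carrier (MR V E)"
      and "?a \<otimes>\<^bsub>MR V E\<^esub> b \<otimes>\<^bsub>MR V E\<^esub> ?a = ?a"
    using regular_monoid.regular[OF assms edge_to_nonedge_in_MR[OF uv(2,3) xy]] by blast
  then have eq: "?a \<circ>\<^sub>m (b \<circ>\<^sub>m ?a) = ?a"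
    by (simp add: MR_def)
  have "b x = Some u"
    using fun_cong[OF eq, of u] uv(4) xy(3)
    by (auto simp: map_comp_def split: option.splits if_splits)
  moreover have "b y = Some v"
    using fun_cong[OF eq, of v] uv(4) xy(3)
    by (auto simp: map_comp_def split: option.splits if_splits)
  ultimately have "{x, y} \<in> E"
    using MR_edge_lift[OF b uv(1)] xy(3) by blast
  with xy(4) show False ..
qed

end

theorem proposition4p4:
  fixes V :: "'a set" and E :: "'a set set"
  assumes "finite_simple_graph V E"
  shows "regular_monoid (MR V E) \<longleftrightarrow> edgeless_graph V E \<or> complete_graph V E"
proof -
  interpret finite_simple_graph V E by (rule assms)
  show ?thesis
    using edgeless_or_complete_if_regular_MR regular_MR by blast
qed

end
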